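(* Let $G$ and $H$ be finitely generated groups, each equipped with a left-invariant word metric associated to some finite symmetric generating set. If $H$ admits a translation-like action on $G$, then $H\rightarrow_{reg} G$, i.e. there exists a regular map from $H$ to $G$.
   Context: Word metric: for a finitely generated group $G$ with a finite symmetric generating set $T$, let $\ell_G$ be the word length associated to $T$ and let $d_G(x,y):=\ell_G(x^{-1}y)$ for $x,y\in G$; this is a left-invariant metric. Finitely generated groups are regarded as metric spaces in this way. Translation-like action: let $H$ be a group and $(X,d)$ a metric space. A left action $*$ of $H$ on (the set) $X$ is translation-like if (i) the action is free, i.e. $h*x=x$ for some $x\in X$ implies $h=1_H$; and (ii) for every $h\in H$ the set $\{d(x,h*x) : x\in X\}$ is bounded. A translation-like action of $H$ on a finitely generated group $G$ means a translation-like action on the metric space $(G,d_G)$ (an action on the underlying set of $G$, not necessarily by automorphisms or translations). Regular map: let $(Z,d_Z)$, $(X,d_X)$ be metric spaces and $\kappa<\infty$. A (not necessarily continuous) map $f:Z\to X$ is $\kappa$-regular if (i) $d_X(f(z_0),f(z_1))\le \kappa(1+d_Z(z_0,z_1))$ for all $z_0,z_1\in Z$; and (ii) for every open ball $B=B(x_0,1)$ of radius $1$ in $X$, the preimage $f^{-1}(B)$ can be covered by $\kappa$ open balls of radius $1$ in $Z$. A map is regular if it is $\kappa$-regular for some finite $\kappa$. Write $Z\rightarrow_{reg}X$ if there is a regular map from $Z$ to $X$. *)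

theory Defs
  imports
    "HOL-Analysis.Analysis"
    "HOL-Algebra.Generated_Groups"
    "HOL-Algebra.Group_Action"
begin

section \<open>Word metrics\<close>

definition finite_symmetric_generating_set :: "('a, 'b) monoid_scheme \<Rightarrow> 'a set \<Rightarrow> bool" where
  "finite_symmetric_generating_set G T \<longleftrightarrow>
     finite T \<and> T \<subseteq> carrier G \<and> (\<forall>t\<in>T. inv\<^bsub>G\<^esub> t \<in> T) \<and> generate G T = carrier G"

definition word_prod :: "('a, 'b) monoid_scheme \<Rightarrow> 'a list \<Rightarrow> 'a" where
  "word_prod G ws = foldr (\<otimes>\<^bsub>G\<^esub>) ws \<one>\<^bsub>G\<^esub>"

definition word_length :: "('a, 'b) monoid_scheme \<Rightarrow> 'a set \<Rightarrow> 'a \<Rightarrow> nat" where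
  "word_length G T x = (LEAST n. \<exists>ws. set ws \<subseteq> T \<and> length ws = n \<and> word_prod G ws = x)"

text \<open>The library locale for metric spaces requires symmetry and nonnegativity of the distance
  function on the whole type, hence the value 0 outside the carrier.\<close>

definition word_dist :: "('a, 'b) monoid_scheme \<Rightarrow> 'a set \<Rightarrow> 'a \<Rightarrow> 'a \<Rightarrow> real" where
  "word_dist G T x y =
     (if x \<in> carrier G \<and> y \<in> carrier G
      then real (word_length G T (inv\<^bsub>G\<^esub> x \<otimes>\<^bsub>G\<^esub> y)) else 0)"

definition word_metric :: "('a, 'b) monoid_scheme \<Rightarrow> 'a set \<Rightarrow> 'a metric" where
  "word_metric G T = metric (carrier G, word_dist G T)"

context group
begin

lemma word_prod_Nil [simp]: "word_prod G [] = \<one>"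
  and word_prod_Cons [simp]: "word_prod G (w # ws) = w \<otimes> word_prod G ws"
  by (simp_all add: word_prod_def)

lemma word_prod_closed: "set ws \<subseteq> carrier G \<Longrightarrow> word_prod G ws \<in> carrier G"
  by (induction ws) auto

lemma word_prod_append:
  "set us \<subseteq> carrier G \<Longrightarrow> set ws \<subseteq> carrier G \<Longrightarrow>
     word_prod G (us @ ws) = word_prod G us \<otimes> word_prod G ws"
  by (induction us) (auto simp: m_assoc word_prod_closed)

lemma word_prod_inv:
  "set ws \<subseteq> carrier G \<Longrightarrow> word_prod G (rev (map (m_inv G) ws)) = inv (word_prod G ws)"
proof (induction ws)
  case (Cons w ws)
  then show ?case
    by (subst list.map, subst rev.simps, subst word_prod_append)
       (auto simp: inv_mult_group word_prod_closed)
qed simp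

lemma generated_word:
  assumes "finite_symmetric_generating_set G T" "x \<in> carrier G"
  shows "\<exists>ws. set ws \<subseteq> T \<and> word_prod G ws = x"
proof -
  have T: "T \<subseteq> carrier G" "\<And>t. t \<in> T \<Longrightarrow> inv t \<in> T" and "x \<in> generate G T"
    using assms by (auto simp: finite_symmetric_generating_set_def)
  from this(3) show ?thesis
  proof induction
    case one
    then show ?case by (intro exI[of _ "[]"]) auto
  next
    case (incl h)
    then show ?case using T by (intro exI[of _ "[h]"]) auto
  next
    case (inv h)
    then show ?case using T by (intro exI[of _ "[inv h]"]) auto
  next
    case (eng h1 h2)
    then obtain us ws where "set us \<subseteq> T" "word_prod G us = h1" "set ws \<subseteq> T" "word_prod G ws = h2"
      by blast
    then show ?case using T by (intro exI[of _ "us @ ws"]) (auto simp: word_prod_append)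
  qed
qed

lemma word_length_le: "set ws \<subseteq> T \<Longrightarrow> word_length G T (word_prod G ws) \<le> length ws"
  unfolding word_length_def by (rule Least_le) auto

lemma word_length_witness:
  assumes "finite_symmetric_generating_set G T" "x \<in> carrier G"
  obtains ws where "set ws \<subseteq> T" "length ws = word_length G T x" "word_prod G ws = x"
proof -
  have "\<exists>n ws. set ws \<subseteq> T \<and> length ws = n \<and> word_prod G ws = x"
    using generated_word[OF assms] by blast
  then have "\<exists>ws. set ws \<subseteq> T \<and> length ws = word_length G T x \<and> word_prod G ws = x"
    unfolding word_length_def by (rule LeastI_ex)
  with that show ?thesis by blast
qed

lemma word_length_eq_0_iff:
  assumes "finite_symmetric_generating_set G T" "x \<in> carrier G"
  shows "word_length G T x = 0 \<longleftrightarrow> x = \<one>"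
  using word_length_witness[OF assms] word_length_le[of "[]" T]
  by (metis le_zero_eq length_0_conv list.size(3) set_empty empty_subsetI word_prod_Nil)

lemma word_length_inv_le:
  assumes "finite_symmetric_generating_set G T" "x \<in> carrier G"
  shows "word_length G T (inv x) \<le> word_length G T x"
proof -
  have T: "T \<subseteq> carrier G" "\<And>t. t \<in> T \<Longrightarrow> inv t \<in> T"
    using assms by (auto simp: finite_symmetric_generating_set_def)
  obtain ws where ws: "set ws \<subseteq> T" "length ws = word_length G T x" "word_prod G ws = x"
    using word_length_witness[OF assms] .
  have "set (rev (map (m_inv G) ws)) \<subseteq> T" using T ws by auto
  from word_length_le[OF this] show ?thesis
    using ws T by (subst (asm) word_prod_inv) auto
qed

lemma word_length_mult_le:
  assumes "finite_symmetric_generating_set G T" "x \<in> carrier G" "y \<in> carrier G"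
  shows "word_length G T (x \<otimes> y) \<le> word_length G T x + word_length G T y"
proof -
  have T: "T \<subseteq> carrier G"
    using assms by (auto simp: finite_symmetric_generating_set_def)
  obtain us where us: "set us \<subseteq> T" "length us = word_length G T x" "word_prod G us = x"
    using word_length_witness[OF assms(1,2)] .
  obtain ws where ws: "set ws \<subseteq> T" "length ws = word_length G T y" "word_prod G ws = y"
    using word_length_witness[OF assms(1,3)] .
  have "set (us @ ws) \<subseteq> T" using us ws by auto
  from word_length_le[OF this] show ?thesis
    using us ws T by (subst (asm) word_prod_append) auto
qed

lemma Metric_space_word_dist:
  assumes T: "finite_symmetric_generating_set G T"
  shows "Metric_space (carrier G) (word_dist G T)"
proof
  show "0 \<le> word_dist G T x y" for x y
    by (simp add: word_dist_def)
  have le: "word_dist G T x y \<le> word_dist G T y x" if "x \<in> carrier G" "y \<in> carrier G" for x y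
    using that word_length_inv_le[OF T, of "inv y \<otimes> x"]
    by (simp add: word_dist_def inv_mult_group)
  show "word_dist G T x y = word_dist G T y x" for x y
  proof (cases "x \<in> carrier G \<and> y \<in> carrier G")
    case True
    then show ?thesis using le by (meson order_antisym)
  qed (auto simp: word_dist_def)
  show "word_dist G T x y = 0 \<longleftrightarrow> x = y" if "x \<in> carrier G" "y \<in> carrier G" for x y
    using that word_length_eq_0_iff[OF T, of "inv x \<otimes> y"]
    by (simp add: word_dist_def) (metis inv_closed inv_inv inv_equality l_inv)
  show "word_dist G T x z \<le> word_dist G T x y + word_dist G T y z"
    if "x \<in> carrier G" "y \<in> carrier G" "z \<in> carrier G" for x y z
  proof -
    have "y \<otimes> (inv y \<otimes> z) = z"
      using that by (simp add: m_assoc[symmetric])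
    then have "inv x \<otimes> z = (inv x \<otimes> y) \<otimes> (inv y \<otimes> z)"
      using that by (simp add: m_assoc)
    then show ?thesis
      using that word_length_mult_le[OF T, of "inv x \<otimes> y" "inv y \<otimes> z"]
      by (simp add: word_dist_def flip: of_nat_add)
  qed
qed

lemma mspace_word_metric:
  "finite_symmetric_generating_set G T \<Longrightarrow> mspace (word_metric G T) = carrier G"
  and mdist_word_metric:
  "finite_symmetric_generating_set G T \<Longrightarrow> mdist (word_metric G T) = word_dist G T"
  by (simp_all add: word_metric_def Metric_space_word_dist
      Metric_space.mspace_metric Metric_space.mdist_metric)

end

section \<open>Translation-like actions\<close>

text \<open>Since multiplication in \<^term>\<open>BijGroup X\<close> is composition with the right factor applied first,
  the library's actions are left actions.\<close>

definition translation_like_action ::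
    "('h, 'c) monoid_scheme \<Rightarrow> 'a metric \<Rightarrow> ('h \<Rightarrow> 'a \<Rightarrow> 'a) \<Rightarrow> bool" where
  "translation_like_action H X \<phi> \<longleftrightarrow>
     group_action H (mspace X) \<phi> \<and>
     (\<forall>h\<in>carrier H. (\<exists>x\<in>mspace X. \<phi> h x = x) \<longrightarrow> h = \<one>\<^bsub>H\<^esub>) \<and>
     (\<forall>h\<in>carrier H. bounded {mdist X x (\<phi> h x) | x. x \<in> mspace X})"

section \<open>Regular maps\<close>

text \<open>Being covered by \<open>\<kappa>\<close> balls means being covered by at most \<open>\<kappa>\<close> balls; \<open>\<kappa>\<close> need not be an integer.\<close>

definition kappa_regular_map :: "real \<Rightarrow> 'a metric \<Rightarrow> 'b metric \<Rightarrow> ('a \<Rightarrow> 'b) \<Rightarrow> bool" where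
  "kappa_regular_map \<kappa> Z X f \<longleftrightarrow>
     f \<in> mspace Z \<rightarrow> mspace X \<and>
     (\<forall>z0\<in>mspace Z. \<forall>z1\<in>mspace Z. mdist X (f z0) (f z1) \<le> \<kappa> * (1 + mdist Z z0 z1)) \<and>
     (\<forall>x0\<in>mspace X. \<exists>C. finite C \<and> C \<subseteq> mspace Z \<and> real (card C) \<le> \<kappa> \<and>
        {z \<in> mspace Z. f z \<in> mball_of X x0 1} \<subseteq> (\<Union>c\<in>C. mball_of Z c 1))"

definition regular_map :: "'a metric \<Rightarrow> 'b metric \<Rightarrow> ('a \<Rightarrow> 'b) \<Rightarrow> bool" where
  "regular_map Z X f \<longleftrightarrow> (\<exists>\<kappa>. kappa_regular_map \<kappa> Z X f)"

definition regularly_maps_to :: "'a metric \<Rightarrow> 'b metric \<Rightarrow> bool"  (infix "\<rightarrow>\<^sub>r\<^sub>e\<^sub>g" 50) where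
  "Z \<rightarrow>\<^sub>r\<^sub>e\<^sub>g X \<longleftrightarrow> (\<exists>f. regular_map Z X f)"

end

theory Submission
  imports Defs
begin

text \<open>The inverse orbit map \<open>h \<mapsto> h\<inverse> * 1\<close> is regular. The inverse is needed because the word metric is
  left-invariant: \<open>h s\<close> is sent to \<open>s\<inverse> * (h\<inverse> * 1)\<close>, and generators displace points by a
  bounded amount. Freeness makes the map injective, and an open unit ball in a word metric is a point.\<close>

text \<open>A shortest word for \<open>g\<close> moves \<open>x\<close> one letter at a time,
  starting from the right end of the word. As \<open>K\<close> bounds the displacement by a
  generator at every point, each letter adds at most \<open>K\<close> to the distance from
  \<open>x\<close>.\<close>

lemma (in group_action) displacement_le_word_length:
  assumes S: "finite_symmetric_generating_set G S"
    and E: "E = mspace X"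
    and K: "\<And>s x. s \<in> S \<Longrightarrow> x \<in> E \<Longrightarrow> mdist X x (\<phi> s x) \<le> K"
    and g: "g \<in> carrier G" and x: "x \<in> E"
  shows "mdist X x (\<phi> g x) \<le> K * real (word_length G S g)"
proof -
  interpret group G by (rule group_hom[unfolded group_hom_def, THEN conjunct1])
  have SG: "S \<subseteq> carrier G"
    using S by (simp add: finite_symmetric_generating_set_def)
  have *: "mdist X x (\<phi> (word_prod G ws) x) \<le> K * real (length ws)" if "set ws \<subseteq> S" for ws
    using that
  proof (induction ws)
    case Nil
    have "mdist X x x = 0"
      using x E by simp
    then show ?case
      using x by (simp add: id_eq_one[symmetric])
  next
    case (Cons s ws)
    let ?y = "\<phi> (word_prod G ws) x"
    have s: "s \<in> S" "s \<in> carrier G" and ws: "word_prod G ws \<in> carrier G"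
      using Cons.prems SG by (auto intro!: word_prod_closed)
    have y: "?y \<in> E" "\<phi> s ?y \<in> E"
      using element_image[OF ws x refl] element_image[OF s(2)] by auto
    have "mdist X x (\<phi> s ?y) \<le> mdist X x ?y + mdist X ?y (\<phi> s ?y)"
      using x y E by (simp add: mdist_triangle)
    also have "\<dots> \<le> K * real (length ws) + K"
      using Cons K[OF s(1) y(1)] by (intro add_mono) auto
    finally show ?case
      using composition_rule[OF x s(2) ws] by (simp add: algebra_simps)
  qed
  obtain ws where "set ws \<subseteq> S" "length ws = word_length G S g" "word_prod G ws = g"
    using word_length_witness[OF S g] .
  with *[of ws] show ?thesis by simp
qed

text \<open>If \<open>a\<close> and \<open>b\<close> have the same image, then
  \<open>a \<otimes> inv b\<close> fixes \<open>x\<close>: \<open>\<phi> (inv b)\<close> sends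
  \<open>x\<close> to the common image and \<open>\<phi> a\<close> brings it back.\<close>

lemma (in group_action) inverse_orbit_map_inj:
  assumes free: "\<And>g y. g \<in> carrier G \<Longrightarrow> y \<in> E \<Longrightarrow> \<phi> g y = y \<Longrightarrow> g = \<one>\<^bsub>G\<^esub>"
    and x: "x \<in> E"
  shows "inj_on (\<lambda>g. \<phi> (inv\<^bsub>G\<^esub> g) x) (carrier G)"
proof
  interpret group G by (rule group_hom[unfolded group_hom_def, THEN conjunct1])
  fix a b
  assume ab: "a \<in> carrier G" "b \<in> carrier G" and eq: "\<phi> (inv a) x = \<phi> (inv b) x"
  have "\<phi> (a \<otimes> inv b) x = \<phi> a (\<phi> (inv a) x)"
    using ab x eq by (simp add: composition_rule)
  also have "\<dots> = x"
    using ab x by (simp add: id_eq_one[symmetric] flip: composition_rule)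
  finally have "a \<otimes> inv b = \<one>"
    using free ab x by simp
  then show "a = b"
    using ab by (metis inv_closed inv_equality inv_inv)
qed

text \<open>Word lengths are natural numbers, so a distance below 1 is 0.\<close>

lemma (in group) mball_word_metric_unit:
  assumes T: "finite_symmetric_generating_set G T" and "x \<in> carrier G"
  shows "mball_of (word_metric G T) x 1 = {x}"
proof -
  interpret Metric_space "carrier G" "word_dist G T"
    by (rule Metric_space_word_dist[OF T])
  have "y = x" if "y \<in> carrier G" "word_dist G T x y < 1" for y
  proof -
    have "word_dist G T x y = 0"
      using that by (auto simp: word_dist_def)
    then show ?thesis using that assms by simp
  qed
  then show ?thesis
    using assms by (auto simp: mball_of_def mball_def mspace_word_metric mdist_word_metric)
qed

theorem theorem1p1:
  fixes G :: "('g, 'b) monoid_scheme" and H :: "('h, 'c) monoid_scheme"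
    and S :: "'h set" and T :: "'g set"
  assumes "group G" and "group H"
    and "finite_symmetric_generating_set G T"
    and "finite_symmetric_generating_set H S"
    and "\<exists>\<phi>. translation_like_action H (word_metric G T) \<phi>"
  shows "word_metric H S \<rightarrow>\<^sub>r\<^sub>e\<^sub>g word_metric G T"
proof -
  interpret G: group G by fact
  interpret H: group H by fact
  note T = assms(3) and S = assms(4)
  note G_metric = G.mspace_word_metric[OF T] G.mdist_word_metric[OF T]
  note H_metric = H.mspace_word_metric[OF S] H.mdist_word_metric[OF S]
  let ?X = "word_metric G T"
  obtain \<phi> where act: "group_action H (carrier G) \<phi>"
    and free: "\<And>h x. h \<in> carrier H \<Longrightarrow> x \<in> carrier G \<Longrightarrow> \<phi> h x = x \<Longrightarrow> h = \<one>\<^bsub>H\<^esub>"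
    and bdd: "\<And>h. h \<in> carrier H \<Longrightarrow> bounded {mdist ?X x (\<phi> h x) | x. x \<in> carrier G}"
    using assms(5) unfolding translation_like_action_def G_metric by blast
  interpret group_action H "carrier G" \<phi> by (rule act)
  have SH: "finite S" "S \<subseteq> carrier H"
    using S by (auto simp: finite_symmetric_generating_set_def)
  \<comment> \<open>The action bounds the displacement for each group element separately; finiteness
    of \<open>S\<close> yields one bound for all generators.\<close>
  have "bounded (\<Union>s\<in>S. {mdist ?X x (\<phi> s x) | x. x \<in> carrier G})"
    using SH bdd by (intro bounded_UN) auto
  then obtain K where K: "\<And>s x. s \<in> S \<Longrightarrow> x \<in> carrier G \<Longrightarrow> mdist ?X x (\<phi> s x) \<le> K"
    unfolding bounded_real by (fastforce dest: abs_le_D1)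
  define f where "f h = \<phi> (inv\<^bsub>H\<^esub> h) \<one>\<^bsub>G\<^esub>" for h
  have f_closed: "f h \<in> carrier G" if "h \<in> carrier H" for h
    unfolding f_def using that by (intro element_image[OF _ _ refl]) auto
  have f_inj: "inj_on f (carrier H)"
    unfolding f_def using free by (intro inverse_orbit_map_inj) auto
  \<comment> \<open>\<open>K\<close> serves the Lipschitz condition and 1 counts the balls of the
    cover. The maximum also ensures a nonnegative factor: for empty \<open>S\<close>,
    \<open>K\<close> is arbitrary and may be negative.\<close>
  have "kappa_regular_map (max 1 K) (word_metric H S) ?X f"
    unfolding kappa_regular_map_def H_metric G_metric(1)
  proof (intro conjI ballI)
    show "f \<in> carrier H \<rightarrow> carrier G"
      using f_closed by blast
  next
    fix a b assume ab: "a \<in> carrier H" "b \<in> carrier H"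
    \<comment> \<open>This element carries \<open>f a\<close> to \<open>f b\<close>, because
      \<open>inv b\<close> is the product of \<open>?g\<close> and \<open>inv a\<close>.\<close>
    let ?g = "inv\<^bsub>H\<^esub> b \<otimes>\<^bsub>H\<^esub> a"
    have "f b = \<phi> (?g \<otimes>\<^bsub>H\<^esub> inv\<^bsub>H\<^esub> a) \<one>\<^bsub>G\<^esub>"
      using ab by (simp add: f_def H.m_assoc)
    also have "\<dots> = \<phi> ?g (f a)"
      using ab by (simp add: f_def composition_rule)
    finally have "mdist ?X (f a) (f b) \<le> K * real (word_length H S ?g)"
      using displacement_le_word_length[OF S G_metric(1)[symmetric] K, of ?g "f a"] ab f_closed
      by simp
    \<comment> \<open>The length of \<open>?g\<close> is by definition the distance from
      \<open>b\<close> to \<open>a\<close>, so symmetry of the metric is used.\<close>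
    also have "\<dots> = K * word_dist H S a b"
      using ab Metric_space.commute[OF H.Metric_space_word_dist[OF S], of a b]
      by (simp add: word_dist_def)
    also have "\<dots> \<le> max 1 K * word_dist H S a b"
      by (intro mult_right_mono) (auto simp: word_dist_def)
    also have "\<dots> \<le> max 1 K * (1 + word_dist H S a b)"
      by (intro mult_mono) (auto simp: word_dist_def)
    finally show "mdist ?X (f a) (f b) \<le> max 1 K * (1 + word_dist H S a b)" .
  next
    fix x assume x: "x \<in> carrier G"
    let ?C = "{h \<in> carrier H. f h \<in> mball_of ?X x 1}"
    have C: "?C = {h \<in> carrier H. f h = x}"
      using x by (simp add: G.mball_word_metric_unit[OF T])
    \<comment> \<open>If \<open>x\<close> is not a value of \<open>f\<close>, then \<open>?C\<close>
      is empty and the unspecified value of \<open>inv_into\<close> does no harm.\<close>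
    have "?C \<subseteq> {inv_into (carrier H) f x}"
      unfolding C using f_inj by (auto simp: inv_into_f_f)
    then have "finite ?C" "card ?C \<le> 1"
      using finite_subset card_mono[of "{inv_into (carrier H) f x}" ?C] by auto
    \<comment> \<open>The preimage itself provides the centres, each point lying in its own
      ball.\<close>
    moreover have "?C \<subseteq> (\<Union>c\<in>?C. mball_of (word_metric H S) c 1)"
      by (auto simp: H.mball_word_metric_unit[OF S])
    ultimately show "\<exists>C. finite C \<and> C \<subseteq> carrier H \<and> real (card C) \<le> max 1 K \<and>
        ?C \<subseteq> (\<Union>c\<in>C. mball_of (word_metric H S) c 1)"
      by (intro exI[of _ ?C]) auto
  qed
  then show ?thesis
    unfolding regularly_maps_to_def regular_map_def by blast
qed

end
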